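(* Let $\mathscr R$ denote the set of all real roots of the Littlewood polynomials. Then the closure of $\mathscr R$ (in $\mathbb R$) is $[-2,-1/2]\cup[1/2,2]$.
   Context: A Littlewood polynomial is a polynomial all of whose coefficients (from the constant to the leading coefficient) are $-1$ or $+1$, i.e. $P(x)=\sum_{m=0}^n\rho_mx^m$ with $\rho_m\in\{-1,+1\}$. *)

theory Defs
  imports "HOL-Analysis.Analysis" "HOL-Computational_Algebra.Polynomial"
begin

text \<open>The zero polynomial is excluded: its degree is 0 in the library, and its coefficient at
  index 0 is neither -1 nor 1.\<close>

definition littlewood_poly :: "real poly \<Rightarrow> bool" where
  "littlewood_poly p \<longleftrightarrow> (\<forall>m\<le>degree p. coeff p m \<in> {-1, 1})"

definition littlewood_real_roots :: "real set" where
  "littlewood_real_roots = {x. \<exists>p. littlewood_poly p \<and> poly p x = 0}"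

end

theory Submission
  imports Defs "HOL-Complex_Analysis.Complex_Analysis"
begin

text \<open>The set of roots is invariant under negation and inversion, so it suffices to find a root in
  every interval \<open>[a, b]\<close> inside \<open>(1/2, 1)\<close>. Build the polynomials \<open>P\<^sub>n\<close> greedily at a point
  \<open>x\<close>, each new sign being opposite to that of \<open>P\<^sub>n(x)\<close>; since \<open>x \<ge> 1/2\<close> this gives
  \<open>\<bar>P\<^sub>n(x)\<bar> \<le> x\<^sup>n\<close>. If no Littlewood polynomial vanished on \<open>[a, b]\<close>, the greedy signs would not
  depend on \<open>x \<in> [a, b]\<close>, and the resulting power series, whose constant term is 1, would vanish
  on all of \<open>[a, b]\<close>, against the identity theorem.\<close>

text \<open>Sign sequences on all of \<open>nat\<close>, cut off at \<open>n\<close>, are easier to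
  twist, reverse and extend than polynomials.\<close>

lemma littlewood_real_roots_iff:
  "x \<in> littlewood_real_roots \<longleftrightarrow>
    (\<exists>n \<rho>. (\<forall>m. \<rho> m \<in> {-1, 1}) \<and> (\<Sum>m\<le>n. \<rho> m * x ^ m) = 0)"
proof
  assume "x \<in> littlewood_real_roots"
  then obtain p where p: "littlewood_poly p" "poly p x = 0"
    by (auto simp: littlewood_real_roots_def)
  \<comment> \<open>The default 1 above the degree keeps every value a sign; a default 0 would
    not.\<close>
  define \<rho> where "\<rho> m = (if m \<le> degree p then coeff p m else 1)" for m
  have "\<forall>m. \<rho> m \<in> {-1, 1}"
    using p(1) by (auto simp: littlewood_poly_def \<rho>_def)
  moreover have "(\<Sum>m\<le>degree p. \<rho> m * x ^ m) = 0"
    using p(2) by (simp add: \<rho>_def poly_altdef)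
  ultimately show "\<exists>n \<rho>. (\<forall>m. \<rho> m \<in> {-1, 1}) \<and> (\<Sum>m\<le>n. \<rho> m * x ^ m) = 0"
    by blast
next
  assume "\<exists>n \<rho>. (\<forall>m. \<rho> m \<in> {-1, 1}) \<and> (\<Sum>m\<le>n. \<rho> m * x ^ m) = 0"
  then obtain n \<rho> where \<rho>: "\<And>m. \<rho> m \<in> {-1, 1}" and z: "(\<Sum>m\<le>n. \<rho> m * x ^ m) = 0"
    by blast
  define p where "p = (\<Sum>m\<le>n. monom (\<rho> m) m)"
  have c: "coeff p k = (if k \<le> n then \<rho> k else 0)" for k
    by (simp add: p_def coeff_sum)
  have "degree p \<le> n"
    by (rule degree_le) (simp add: c)
  then have "littlewood_poly p"
    using \<rho> by (simp add: littlewood_poly_def c)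
  moreover have "poly p x = 0"
    using z by (simp add: p_def poly_sum poly_monom)
  ultimately show "x \<in> littlewood_real_roots"
    by (auto simp: littlewood_real_roots_def)
qed

text \<open>Substituting \<open>- x\<close> flips the signs at odd indices only.\<close>

lemma uminus_littlewood_real_roots:
  assumes "x \<in> littlewood_real_roots"
  shows "- x \<in> littlewood_real_roots"
proof -
  obtain n \<rho> where \<rho>: "\<And>m. \<rho> m \<in> {-1, 1}" and z: "(\<Sum>m\<le>n. \<rho> m * x ^ m) = 0"
    using assms by (auto simp: littlewood_real_roots_iff)
  define \<sigma> where "\<sigma> m = \<rho> m * (-1) ^ m" for m
  have "\<sigma> m \<in> {-1, 1}" for m
    using \<rho>[of m] by (cases "even m") (auto simp: \<sigma>_def)
  moreover have "(\<Sum>m\<le>n. \<sigma> m * (- x) ^ m) = (\<Sum>m\<le>n. \<rho> m * x ^ m)"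
    by (simp add: \<sigma>_def mult.assoc flip: power_mult_distrib)
  ultimately show ?thesis
    using z unfolding littlewood_real_roots_iff by metis
qed

text \<open>Reversing the coefficients gives the reciprocal polynomial, whose value at
  \<open>inverse x\<close> is the original value at \<open>x\<close> times
  \<open>inverse x ^ n\<close>.\<close>

lemma inverse_littlewood_real_roots:
  assumes "x \<in> littlewood_real_roots" "x \<noteq> 0"
  shows "inverse x \<in> littlewood_real_roots"
proof -
  obtain n \<rho> where \<rho>: "\<And>m. \<rho> m \<in> {-1, 1}" and z: "(\<Sum>m\<le>n. \<rho> m * x ^ m) = 0"
    using assms by (auto simp: littlewood_real_roots_iff)
  have "(\<Sum>m\<le>n. \<rho> (n - m) * inverse x ^ m) = (\<Sum>m\<le>n. \<rho> m * inverse x ^ (n - m))"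
    by (rule sum.reindex_bij_witness[of _ "\<lambda>m. n - m" "\<lambda>m. n - m"]) auto
  also have "\<dots> = (\<Sum>m\<le>n. \<rho> m * x ^ m) * inverse x ^ n"
    unfolding sum_distrib_right
    using assms(2) by (intro sum.cong) (auto simp: power_diff field_simps)
  finally have "(\<Sum>m\<le>n. \<rho> (n - m) * inverse x ^ m) = 0"
    using z by simp
  then show ?thesis
    unfolding littlewood_real_roots_iff
    using \<rho> by (intro exI[of _ n] exI[of _ "\<lambda>m. \<rho> (n - m)"]) blast
qed

text \<open>For smaller \<open>\<bar>x\<bar>\<close> the constant term, of absolute value 1,
  outweighs all other terms together.\<close>

lemma littlewood_real_roots_abs_ge:
  assumes "x \<in> littlewood_real_roots"
  shows "1/2 \<le> \<bar>x\<bar>"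
proof (rule ccontr)
  assume less: "\<not> 1/2 \<le> \<bar>x\<bar>"
  obtain n \<rho> where \<rho>: "\<And>m. \<rho> m \<in> {-1, 1}" and z: "(\<Sum>m\<le>n. \<rho> m * x ^ m) = 0"
    using assms by (auto simp: littlewood_real_roots_iff)
  have abs\<rho>: "\<bar>\<rho> m\<bar> = 1" for m
    using \<rho>[of m] by auto
  have "(\<Sum>m\<le>n. \<rho> m * x ^ m) = \<rho> 0 + (\<Sum>m<n. \<rho> (Suc m) * x ^ Suc m)"
    by (subst sum.atMost_shift) simp
  then have "\<bar>\<rho> 0\<bar> = \<bar>\<Sum>m<n. \<rho> (Suc m) * x ^ Suc m\<bar>"
    using z by linarith
  also have "\<dots> \<le> (\<Sum>m<n. \<bar>x\<bar> ^ Suc m)"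
    by (rule order_trans[OF sum_abs]) (simp add: abs_mult power_abs abs\<rho>)
  also have "\<dots> \<le> (\<Sum>m<n. (1/2) ^ Suc m)"
    using less by (intro sum_mono power_mono) auto
  \<comment> \<open>Strictness comes from here: the finite geometric sum misses the tail
    \<open>(1/2) ^ n\<close>.\<close>
  also have "\<dots> = 1 - (1/2) ^ n"
    by (induction n) auto
  also have "\<dots> < 1"
    by simp
  finally show False
    by (simp add: abs\<rho>)
qed

text \<open>Bounded coefficients make the series holomorphic on the complex unit disc. Its zeros
  accumulate at \<open>a\<close>, so it vanishes on the disc, in particular at 0.\<close>

lemma power_series_zero_on_interval:
  fixes \<rho> :: "nat \<Rightarrow> real"
  assumes ab: "0 < a" "a < b" "b < 1"
    and bounded: "\<And>n. \<bar>\<rho> n\<bar> \<le> 1"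
    and zero: "\<And>x. a \<le> x \<Longrightarrow> x \<le> b \<Longrightarrow> (\<lambda>n. \<rho> n * x ^ n) sums 0"
  shows "\<rho> 0 = 0"
proof -
  define F :: "complex \<Rightarrow> complex" where "F z = (\<Sum>n. of_real (\<rho> n) * z ^ n)" for z
  have F: "(\<lambda>n. of_real (\<rho> n) * z ^ n) sums F z" if "norm z < 1" for z
  proof -
    have "summable (\<lambda>n. of_real (\<rho> n) * z ^ n)"
    proof (rule summable_comparison_test')
      show "summable (\<lambda>n. norm z ^ n)"
        using that by (simp add: summable_geometric)
      show "norm (of_real (\<rho> n) * z ^ n) \<le> norm z ^ n" for n
        using bounded[of n] by (simp add: norm_mult norm_power mult_left_le_one_le)
    qed
    then show ?thesis
      unfolding F_def by (rule summable_sums)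
  qed
  have "F holomorphic_on ball 0 1"
    by (rule power_series_holomorphic[where a = "\<lambda>n. of_real (\<rho> n)"]) (use F in auto)
  moreover have "complex_of_real a islimpt of_real ` {a..b}"
  proof (rule islimpt_isCont_image)
    show "a islimpt {a..b}"
      using ab by (simp add: islimpt_Icc)
    show "eventually (\<lambda>y. complex_of_real y \<noteq> of_real a) (at a)"
      by (auto simp: eventually_at intro!: exI[of _ 1])
  qed auto
  moreover have "F z = 0" if z: "z \<in> of_real ` {a..b}" for z
  proof -
    obtain x where x: "z = of_real x" "a \<le> x" "x \<le> b"
      using z by auto
    have "(\<lambda>n. complex_of_real (\<rho> n * x ^ n)) sums of_real 0"
      using zero[OF x(2,3)] by (simp only: sums_of_real_iff)
    moreover have "(\<lambda>n. complex_of_real (\<rho> n * x ^ n)) sums F z"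
      using F[of z] x ab by simp
    ultimately show ?thesis
      using sums_unique2 by fastforce
  qed
  moreover have "of_real ` {a..b} \<subseteq> ball (0::complex) 1"
    using ab by auto
  ultimately have "F 0 = 0"
    using ab by (intro analytic_continuation[of F "ball 0 1" "of_real ` {a..b}" "of_real a" 0]) auto
  then show ?thesis
    using powser_zero[of "\<lambda>n. complex_of_real (\<rho> n)"] by (simp add: F_def)
qed

text \<open>Only values are recorded, since the signs chosen, and hence the polynomial, may vary
  with \<open>x\<close>.\<close>

fun greedy_sum :: "real \<Rightarrow> nat \<Rightarrow> real" where
  "greedy_sum x 0 = 1"
| "greedy_sum x (Suc n) = greedy_sum x n + (if greedy_sum x n > 0 then -1 else 1) * x ^ Suc n"

text \<open>The new absolute value is the distance between the old one, in
  \<open>[0, x ^ n]\<close>, and \<open>x ^ Suc n\<close>. It is at most \<open>x ^ Suc n\<close>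
  because \<open>x ^ n \<le> 2 * x ^ Suc n\<close>.\<close>

lemma greedy_sum_bound:
  assumes "1/2 \<le> x"
  shows "\<bar>greedy_sum x n\<bar> \<le> x ^ n"
proof (induction n)
  case (Suc n)
  have "x ^ n \<le> 2 * x ^ Suc n"
    using mult_right_mono[of 1 "2 * x" "x ^ n"] assms by simp
  moreover have "0 < x ^ Suc n"
    using assms by simp
  ultimately show ?case
    using Suc by (simp only: greedy_sum.simps abs_le_iff split: if_splits) linarith
qed simp

lemma littlewood_real_root_between:
  assumes "1/2 < a" "a < b" "b < 1"
  shows "\<exists>r\<in>littlewood_real_roots. a \<le> r \<and> r \<le> b"
proof (rule ccontr)
  assume none: "\<not> ?thesis"
  \<comment> \<open>The greedy signs at the left endpoint; they turn out to be the greedy signs at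
    every point of the interval.\<close>
  define \<rho> where
    "\<rho> n = (case n of 0 \<Rightarrow> 1 :: real | Suc k \<Rightarrow> (if greedy_sum a k > 0 then -1 else 1))" for n
  have \<rho>: "\<rho> n \<in> {-1, 1}" for n
    by (auto simp: \<rho>_def split: nat.split)
  define P where "P n x = (\<Sum>m\<le>n. \<rho> m * x ^ m)" for n x
  have same_sign: "P n x > 0 \<longleftrightarrow> P n a > 0" if x: "a \<le> x" "x \<le> b" for n x
  proof (rule ccontr)
    assume *: "\<not> ?thesis"
    have cont: "continuous_on {a..x} (P n)"
      unfolding P_def by (intro continuous_intros)
    \<comment> \<open>If positivity differs at \<open>a\<close> and \<open>x\<close>, the
      intermediate value theorem gives a zero between them, possibly at an endpoint.\<close>
    have "\<exists>r. a \<le> r \<and> r \<le> x \<and> P n r = 0"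
    proof (cases "P n a > 0")
      case True
      then show ?thesis
        using * IVT2'[of "P n" x 0 a] cont x by auto
    next
      case False
      then show ?thesis
        using * IVT'[of "P n" a 0 x] cont x by auto
    qed
    then obtain r where r: "a \<le> r" "r \<le> x" "P n r = 0"
      by blast
    then have "r \<in> littlewood_real_roots"
      using \<rho> unfolding P_def littlewood_real_roots_iff by blast
    then show False
      using none r x by force
  qed
  have greedy_a: "P n a = greedy_sum a n" for n
    by (induction n) (simp_all add: P_def \<rho>_def)
  have greedy: "P n x = greedy_sum x n" if x: "a \<le> x" "x \<le> b" for n x
  proof (induction n)
    case (Suc n)
    have "P (Suc n) x = P n x + \<rho> (Suc n) * x ^ Suc n"
      by (simp add: P_def)
    moreover have "\<rho> (Suc n) = (if greedy_sum x n > 0 then -1 else 1)"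
      using same_sign[OF x, of n] by (simp add: \<rho>_def greedy_a Suc)
    ultimately show ?case
      by (simp add: Suc)
  qed (simp add: P_def \<rho>_def)
  have "(\<lambda>n. \<rho> n * x ^ n) sums 0" if x: "a \<le> x" "x \<le> b" for x
  proof -
    \<comment> \<open>The partial sums are greedy sums at \<open>x\<close>, squeezed by
      \<open>x ^ n\<close> with \<open>x < 1\<close>.\<close>
    have "(\<lambda>n. P n x) \<longlonglongrightarrow> 0"
    proof (rule Lim_null_comparison)
      show "(\<lambda>n. x ^ n) \<longlonglongrightarrow> 0"
        using assms x by (intro LIMSEQ_realpow_zero) auto
      show "eventually (\<lambda>n. norm (P n x) \<le> x ^ n) sequentially"
        using greedy_sum_bound[of x] greedy[OF x] assms x by simp
    qed
    then show ?thesis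
      by (simp add: P_def sums_def_le)
  qed
  then have "\<rho> 0 = 0"
  proof (rule power_series_zero_on_interval[of a b, rotated -1])
    show "\<bar>\<rho> n\<bar> \<le> 1" for n
      using \<rho>[of n] by auto
  qed (use assms in auto)
  then show False
    by (simp add: \<rho>_def)
qed

text \<open>Interior points are approached from the right; the endpoints follow because the closure
  is closed.\<close>

lemma interval_subset_closure:
  fixes l u :: real
  assumes "l < u"
    and dense: "\<And>a b. l < a \<Longrightarrow> a < b \<Longrightarrow> b < u \<Longrightarrow> \<exists>r\<in>S. a \<le> r \<and> r \<le> b"
  shows "{l..u} \<subseteq> closure S"
proof -
  have "x \<in> closure S" if x: "l < x" "x < u" for x
    unfolding closure_approachable
  proof (intro allI impI)
    fix e :: real
    assume "e > 0"
    then obtain b where "x < b" "b < min u (x + e)"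
      using x Orderings.dense[of x "min u (x + e)"] by auto
    then obtain r where "r \<in> S" "x \<le> r" "r \<le> b"
      using dense[of x b] x by auto
    then show "\<exists>y\<in>S. dist y x < e"
      using \<open>b < min u (x + e)\<close> by (intro bexI[of _ r]) (auto simp: dist_real_def)
  qed
  then have "closure {l<..<u} \<subseteq> closure S"
    by (intro closure_minimal) auto
  then show ?thesis
    using assms(1) by simp
qed

theorem corollary4p5:
  "closure littlewood_real_roots = {-2..-(1/2)} \<union> {1/2..2}"
proof
  let ?R = littlewood_real_roots
  show "closure ?R \<subseteq> {-2..-(1/2)} \<union> {1/2..2}"
  proof (rule closure_minimal)
    show "?R \<subseteq> {-2..-(1/2)} \<union> {1/2..2}"
    proof
      fix x
      assume x: "x \<in> ?R"
      have ge: "1/2 \<le> \<bar>x\<bar>"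
        using x by (rule littlewood_real_roots_abs_ge)
      \<comment> \<open>The upper bound 2 is the lower bound 1/2 applied to the inverse
        root.\<close>
      then have "1/2 \<le> \<bar>inverse x\<bar>"
        using x by (intro littlewood_real_roots_abs_ge inverse_littlewood_real_roots) auto
      then have "\<bar>x\<bar> \<le> 2"
        using ge by (simp add: field_simps)
      then show "x \<in> {-2..-(1/2)} \<union> {1/2..2}"
        using ge by auto
    qed
  qed (intro closed_Un closed_atLeastAtMost)
  \<comment> \<open>Inversion carries \<open>[a, b]\<close> to \<open>[inverse b, inverse a]\<close>
    inside \<open>(1/2, 1)\<close>.\<close>
  have inv: "\<exists>r\<in>?R. a \<le> r \<and> r \<le> b" if "1 < a" "a < b" "b < 2" for a b
  proof -
    have "1/2 < inverse b" "inverse b < inverse a" "inverse a < 1"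
      using that by (simp_all add: field_simps)
    then obtain r where r: "r \<in> ?R" "inverse b \<le> r" "r \<le> inverse a"
      using littlewood_real_root_between by blast
    have "0 < r"
      using r(2) that by (smt (verit) positive_imp_inverse_positive)
    then have "a \<le> inverse r" "inverse r \<le> b"
      using r(2,3) that by (simp_all add: field_simps)
    then show ?thesis
      using r(1) \<open>0 < r\<close> inverse_littlewood_real_roots by force
  qed
  have neg: "\<exists>r\<in>?R. a \<le> r \<and> r \<le> b" if "\<exists>r\<in>?R. - b \<le> r \<and> r \<le> - a" for a b
    using that uminus_littlewood_real_roots by (metis minus_le_iff le_minus_iff)
  \<comment> \<open>The target is cut at 1 and -1, where inversion swaps the two ranges; closed
    pieces still cover these points.\<close>
  have "{1/2..1} \<subseteq> closure ?R"
    by (rule interval_subset_closure) (auto intro: littlewood_real_root_between)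
  moreover have "{1..2} \<subseteq> closure ?R"
    by (rule interval_subset_closure) (auto intro: inv)
  moreover have "{-1..-(1/2)} \<subseteq> closure ?R"
    by (rule interval_subset_closure) (simp, rule neg, rule littlewood_real_root_between, auto)
  moreover have "{-2..-1} \<subseteq> closure ?R"
    by (rule interval_subset_closure) (simp, rule neg, rule inv, auto)
  moreover have "{-2..-(1/2)} \<union> {1/2..2} = {-2..-1} \<union> {-1..-(1/2)} \<union> {1/2..1} \<union> {1..2::real}"
    by auto
  ultimately show "{-2..-(1/2)} \<union> {1/2..2} \<subseteq> closure ?R"
    by simp
qed

end
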